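(* Every countable graph is majority $3$-choosable: for every countable (simple) graph $G$ and every assignment of lists $L(v)$, each consisting of exactly $3$ colours, to the vertices $v\in V(G)$, there is a majority colouring $\chi$ of $G$ with $\chi(v)\in L(v)$ for every $v\in V(G)$.
   Context: A majority colouring of a graph $G$ is an assignment $\chi$ of colours to the vertices such that for every vertex $v$: if $v$ has finite degree, at most half of the edges incident with $v$ are monochromatic (i.e. join $v$ to a neighbour $u$ with $\chi(u)=\chi(v)$); if $v$ has infinite degree, the set of non-monochromatic edges at $v$ has the same cardinality as the whole neighbourhood of $v$ (for a countable graph: $v$ has infinitely many neighbours $u$ with $\chi(u)\neq\chi(v)$). A graph is majority $\ell$-choosable if for every system of lists $(L(v))_{v\in V(G)}$ with $|L(v)|=\ell$ there is a majority colouring $\chi$ with $\chi(v)\in L(v)$ for all $v$. *)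

theory Defs
  imports "HOL-Library.Countable_Set" "HOL-Library.Equipollence"
begin

definition simple_graph :: "'a set \<Rightarrow> 'a set set \<Rightarrow> bool" where
  "simple_graph V E \<longleftrightarrow> (\<forall>e\<in>E. e \<subseteq> V \<and> card e = 2)"

definition neighbourhood :: "'a set set \<Rightarrow> 'a \<Rightarrow> 'a set" where
  "neighbourhood E v = {u. {v, u} \<in> E}"

definition incident_edges :: "'a set set \<Rightarrow> 'a \<Rightarrow> 'a set set" where
  "incident_edges E v = {e \<in> E. v \<in> e}"

definition monochromatic :: "('a \<Rightarrow> 'c) \<Rightarrow> 'a set \<Rightarrow> bool" where
  "monochromatic \<chi> e \<longleftrightarrow> (\<forall>u\<in>e. \<forall>w\<in>e. \<chi> u = \<chi> w)"

definition majority_colouring :: "'a set \<Rightarrow> 'a set set \<Rightarrow> ('a \<Rightarrow> 'c) \<Rightarrow> bool" where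
  "majority_colouring V E \<chi> \<longleftrightarrow>
     (\<forall>v\<in>V.
        if finite (incident_edges E v)
        then 2 * card {e \<in> incident_edges E v. monochromatic \<chi> e} \<le> card (incident_edges E v)
        else {e \<in> incident_edges E v. \<not> monochromatic \<chi> e} \<approx> neighbourhood E v)"

text \<open>
  The colours are drawn from an arbitrary type, which does not occur in the graph and is therefore
  passed as an explicit type argument. Finiteness of the lists is only relevant for
  \<open>l = 0\<close>, since infinite sets have \<open>card\<close> zero.
\<close>

definition majority_choosable :: "'c itself \<Rightarrow> nat \<Rightarrow> 'a set \<Rightarrow> 'a set set \<Rightarrow> bool" where
  "majority_choosable (_ :: 'c itself) l V E \<longleftrightarrow>
     (\<forall>L :: 'a \<Rightarrow> 'c set. (\<forall>v\<in>V. finite (L v) \<and> card (L v) = l) \<longrightarrow>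
        (\<exists>\<chi>. majority_colouring V E \<chi> \<and> (\<forall>v\<in>V. \<chi> v \<in> L v)))"

end

theory Submission
  imports Defs "HOL-Analysis.Function_Topology"
begin

text \<open>
  Enumerate the vertices. Each vertex \<open>v\<close> of infinite degree claims infinitely many of its later
  neighbours, no vertex being claimed twice. Recursively along the enumeration, choose
  \<open>\<psi> u \<in> L u\<close> different from the value \<open>\<psi> v\<close> at the claimant \<open>v\<close> of \<open>u\<close>. Vertices of infinite degree
  receive colour \<open>\<psi>\<close>, and a vertex of finite degree is only forbidden the value of \<open>\<psi>\<close> at its
  claimant, so that every vertex of infinite degree is satisfied whatever happens next. As at least
  two colours remain for each vertex of finite degree, these can be satisfied too: finitely many of
  them by minimising the number of monochromatic edges, and all of them by compactness of the
  product of the finite lists.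
\<close>

lemma finite_to_nat_on_le:
  assumes "countable A"
  shows "finite {x \<in> A. to_nat_on A x \<le> n}"
proof (rule inj_on_finite)
  show "inj_on (to_nat_on A) {x \<in> A. to_nat_on A x \<le> n}"
    by (rule inj_on_subset[OF inj_on_to_nat_on[OF assms]]) auto
  show "to_nat_on A ` {x \<in> A. to_nat_on A x \<le> n} \<subseteq> {..n}"
    by auto
qed simp

lemma inj_on_if_neq_of_rank_less:
  fixes r :: "'i \<Rightarrow> 'b::linorder"
  assumes "inj_on r I"
    and neq_if_rank_less: "\<And>i j. i \<in> I \<Longrightarrow> j \<in> I \<Longrightarrow> r i < r j \<Longrightarrow> g i \<noteq> g j"
  shows "inj_on g I"
proof (rule inj_onI)
  fix i j assume ij: "i \<in> I" "j \<in> I" "g i = g j"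
  then have "r i = r j"
    using neq_if_rank_less[of i j] neq_if_rank_less[of j i]
    by (cases "r i" "r j" rule: linorder_cases) auto
  with \<open>inj_on r I\<close> ij show "i = j"
    by (simp add: inj_on_eq_iff)
qed

lemma exists_inj_on_choice_infinite:
  fixes A :: "'i \<Rightarrow> 'a set"
  assumes "countable I" and infinite_A: "\<And>i. i \<in> I \<Longrightarrow> infinite (A i)"
  obtains g where "inj_on g I" "\<And>i. i \<in> I \<Longrightarrow> g i \<in> A i"
proof -
  let ?r = "to_nat_on I"
  define pred where "pred i = {j \<in> I. ?r j < ?r i}" for i
  have finite_pred: "finite (pred i)" for i
    by (rule finite_subset[OF _ finite_to_nat_on_le[OF \<open>countable I\<close>, of "?r i"]])
      (auto simp: pred_def)
  have "\<exists>g. \<forall>i. i \<in> I \<longrightarrow> g i \<in> A i - g ` pred i"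
  proof (rule dependent_wf_choice[OF wf_measure[of ?r]])
    fix g h :: "'i \<Rightarrow> 'a" and i x
    assume "\<And>j. (j, i) \<in> measure ?r \<Longrightarrow> g j = h j"
    then have "g ` pred i = h ` pred i"
      by (intro image_cong) (auto simp: pred_def)
    then show "(i \<in> I \<longrightarrow> x \<in> A i - g ` pred i) = (i \<in> I \<longrightarrow> x \<in> A i - h ` pred i)"
      by simp
  next
    fix i and g :: "'i \<Rightarrow> 'a"
    have "infinite (A i - g ` pred i)" if "i \<in> I"
      using that infinite_A finite_pred by (simp add: Diff_infinite_finite)
    then show "\<exists>x. i \<in> I \<longrightarrow> x \<in> A i - g ` pred i"
      using infinite_imp_nonempty by blast
  qed
  then obtain g where g_fresh: "\<And>i. i \<in> I \<Longrightarrow> g i \<in> A i - g ` pred i"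
    by blast
  have "inj_on g I"
  proof (rule inj_on_if_neq_of_rank_less[OF inj_on_to_nat_on[OF \<open>countable I\<close>]])
    fix i j assume ij: "i \<in> I" "j \<in> I" "?r i < ?r j"
    then have "g i \<in> g ` pred j"
      by (simp add: pred_def)
    with g_fresh[OF \<open>j \<in> I\<close>] show "g i \<noteq> g j" by auto
  qed
  with g_fresh show thesis
    using that by blast
qed

lemma exists_infinite_fibres:
  fixes A :: "'i \<Rightarrow> 'a set"
  assumes "countable I" and infinite_A: "\<And>i. i \<in> I \<Longrightarrow> infinite (A i)"
  obtains p where "\<And>i. i \<in> I \<Longrightarrow> infinite {a \<in> A i. p a = i}"
proof -
  let ?J = "I \<times> (UNIV :: nat set)"
  have "countable ?J"
    using \<open>countable I\<close> by simp
  moreover have "infinite (A (fst j))" if "j \<in> ?J" for j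
    using infinite_A that by auto
  ultimately obtain g where inj_g: "inj_on g ?J" and g_in_A: "\<And>j. j \<in> ?J \<Longrightarrow> g j \<in> A (fst j)"
    using exists_inj_on_choice_infinite[of ?J "\<lambda>j. A (fst j)"] by blast
  show thesis
  proof (rule that)
    fix i assume "i \<in> I"
    have "inj (\<lambda>n. g (i, n))"
      using inj_g \<open>i \<in> I\<close> by (auto simp: inj_on_def)
    moreover have "range (\<lambda>n. g (i, n)) \<subseteq> {a \<in> A i. fst (inv_into ?J g a) = i}"
      using inj_g g_in_A \<open>i \<in> I\<close> by (auto simp: inv_into_f_f)
    ultimately show "infinite {a \<in> A i. fst (inv_into ?J g a) = i}"
      using finite_subset range_inj_infinite by blast
  qed
qed

lemma ex_mem_neq_if_two_le_card:
  assumes "2 \<le> card A"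
  shows "\<exists>x\<in>A. x \<noteq> a"
proof (rule ccontr)
  assume "\<not> ?thesis"
  then have "A \<subseteq> {a}" by blast
  then have "card A \<le> card {a}" by (intro card_mono) auto
  with assms show False by simp
qed

lemma exists_choice_avoiding_parent:
  fixes L :: "'a \<Rightarrow> 'c set"
  assumes "wf R" and two_colours: "\<And>u. u \<in> V \<Longrightarrow> 2 \<le> card (L u)"
  obtains \<psi> where "\<And>u. u \<in> V \<Longrightarrow> \<psi> u \<in> L u"
    "\<And>u. u \<in> V \<Longrightarrow> (p u, u) \<in> R \<Longrightarrow> \<psi> u \<noteq> \<psi> (p u)"
proof -
  have "\<exists>\<psi>. \<forall>u. u \<in> V \<longrightarrow> \<psi> u \<in> L u \<and> ((p u, u) \<in> R \<longrightarrow> \<psi> u \<noteq> \<psi> (p u))"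
  proof (rule dependent_wf_choice[OF \<open>wf R\<close>])
    fix u and \<psi> :: "'a \<Rightarrow> 'c"
    show "\<exists>c. u \<in> V \<longrightarrow> c \<in> L u \<and> ((p u, u) \<in> R \<longrightarrow> c \<noteq> \<psi> (p u))"
      using ex_mem_neq_if_two_le_card[OF two_colours] by blast
  qed auto
  then show thesis
    using that by blast
qed

lemma openin_discrete_product_finitary:
  fixes M :: "'a \<Rightarrow> 'c set"
  assumes "finite W" and P_cong: "\<And>f g. (\<And>v. v \<in> W \<Longrightarrow> f v = g v) \<Longrightarrow> P f \<longleftrightarrow> P g"
  shows "openin (product_topology (\<lambda>v. discrete_topology (M v)) V) {f \<in> Pi\<^sub>E V M. P f}"
proof (subst openin_subopen, intro ballI exI conjI)
  let ?U = "{f \<in> Pi\<^sub>E V M. P f}"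
  fix f assume f: "f \<in> ?U"
  let ?C = "Pi\<^sub>E V (\<lambda>v. if v \<in> W then {f v} else M v)"
  have "finite {v \<in> V. (if v \<in> W then {f v} else M v) \<noteq> M v}"
    by (rule finite_subset[OF _ \<open>finite W\<close>]) auto
  then show "openin (product_topology (\<lambda>v. discrete_topology (M v)) V) ?C"
    using f by (auto simp: openin_PiE_gen)
  show "f \<in> ?C"
    using f by (auto simp: PiE_iff)
  show "?C \<subseteq> ?U"
  proof
    fix g assume g: "g \<in> ?C"
    have "f v = g v" if "v \<in> W" for v
      using f g that by (cases "v \<in> V") (auto simp: PiE_iff extensional_def)
    with P_cong[of f g] f have "P g"
      by blast
    moreover have "g \<in> Pi\<^sub>E V M"
      using f g by (auto simp: PiE_iff split: if_splits)
    ultimately show "g \<in> ?U" by blast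
  qed
qed

lemma exists_PiE_satisfying_finitary:
  fixes M :: "'a \<Rightarrow> 'c set" and Q :: "'i \<Rightarrow> ('a \<Rightarrow> 'c) \<Rightarrow> bool"
  assumes finite_M: "\<And>v. v \<in> V \<Longrightarrow> finite (M v)"
    and finite_W: "\<And>i. i \<in> I \<Longrightarrow> finite (W i)"
    and Q_cong: "\<And>i f g. i \<in> I \<Longrightarrow> (\<And>v. v \<in> W i \<Longrightarrow> f v = g v) \<Longrightarrow> Q i f \<longleftrightarrow> Q i g"
    and finite_sat: "\<And>J. finite J \<Longrightarrow> J \<subseteq> I \<Longrightarrow> \<exists>f \<in> Pi\<^sub>E V M. \<forall>i\<in>J. Q i f"
  shows "\<exists>f \<in> Pi\<^sub>E V M. \<forall>i\<in>I. Q i f"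
proof -
  define X where "X = product_topology (\<lambda>v. discrete_topology (M v)) V"
  have topspace_X: "topspace X = Pi\<^sub>E V M"
    by (simp add: X_def)
  define S where "S i = {f \<in> Pi\<^sub>E V M. Q i f}" for i
  have "closedin X (S i)" if "i \<in> I" for i
  proof -
    have "openin X {f \<in> Pi\<^sub>E V M. \<not> Q i f}"
      unfolding X_def
    proof (rule openin_discrete_product_finitary[OF finite_W[OF \<open>i \<in> I\<close>]])
      fix f g :: "'a \<Rightarrow> 'c" assume "\<And>v. v \<in> W i \<Longrightarrow> f v = g v"
      then show "\<not> Q i f \<longleftrightarrow> \<not> Q i g"
        using Q_cong[OF \<open>i \<in> I\<close>] by blast
    qed
    moreover have "topspace X - S i = {f \<in> Pi\<^sub>E V M. \<not> Q i f}"
      by (auto simp: S_def topspace_X)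
    ultimately show ?thesis
      by (auto simp: closedin_def S_def topspace_X)
  qed
  moreover have "topspace X \<inter> \<Inter> \<F> \<noteq> {}" if "finite \<F>" "\<F> \<subseteq> S ` I" for \<F>
  proof -
    obtain J where "finite J" "J \<subseteq> I" "\<F> = S ` J"
      using finite_subset_image[OF \<open>finite \<F>\<close> \<open>\<F> \<subseteq> S ` I\<close>] by blast
    with finite_sat[of J] show ?thesis
      by (auto simp: S_def topspace_X)
  qed
  moreover have "compact_space X"
    using finite_M by (simp add: X_def compact_space_product_topology compact_space_discrete_topology)
  ultimately have "topspace X \<inter> \<Inter> (S ` I) \<noteq> {}"
    unfolding compact_space_def compactin_fip by (metis imageE)
  then show ?thesis
    by (auto simp: S_def topspace_X)
qed

lemma countable_infinite_eqpoll:
  assumes "countable A" "infinite A" "countable B" "infinite B"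
  shows "A \<approx> B"
proof -
  have "A \<approx> (UNIV :: nat set)" "B \<approx> (UNIV :: nat set)"
    using to_nat_on_infinite assms eqpoll_def by blast+
  then show ?thesis
    using eqpoll_trans eqpoll_sym by blast
qed

lemma incident_edges_eq_image:
  assumes "simple_graph V E"
  shows "incident_edges E v = (\<lambda>u. {v, u}) ` neighbourhood E v"
proof -
  have "e \<in> (\<lambda>u. {v, u}) ` neighbourhood E v" if "e \<in> E" "v \<in> e" for e
  proof -
    have "card e = 2" using assms that by (simp add: simple_graph_def)
    then obtain u where "e = {v, u}"
      using \<open>v \<in> e\<close> by (auto simp: card_2_iff)
    with that show ?thesis by (auto simp: neighbourhood_def)
  qed
  then show ?thesis
    by (auto simp: incident_edges_def neighbourhood_def)
qed

lemma inj_doubleton: "inj (\<lambda>u. {v, u})"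
  by (auto simp: inj_def doubleton_eq_iff)

lemma finite_incident_edges_iff:
  assumes "simple_graph V E"
  shows "finite (incident_edges E v) \<longleftrightarrow> finite (neighbourhood E v)"
  by (simp add: incident_edges_eq_image[OF assms] finite_image_iff inj_on_subset[OF inj_doubleton])

lemma neighbourhood_subset:
  assumes "simple_graph V E"
  shows "neighbourhood E v \<subseteq> V"
  using assms by (auto simp: simple_graph_def neighbourhood_def)

lemma not_self_neighbour:
  assumes "simple_graph V E"
  shows "v \<notin> neighbourhood E v"
  using assms by (auto simp: simple_graph_def neighbourhood_def)

lemma monochromatic_doubleton [simp]: "monochromatic \<chi> {v, u} \<longleftrightarrow> \<chi> u = \<chi> v"
  by (auto simp: monochromatic_def)

lemma monochromatic_cong:
  assumes "\<And>u. u \<in> e \<Longrightarrow> \<chi> u = \<chi>' u"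
  shows "monochromatic \<chi> e \<longleftrightarrow> monochromatic \<chi>' e"
  using assms by (auto simp: monochromatic_def)

definition monochromatic_edges :: "'a set set \<Rightarrow> ('a \<Rightarrow> 'c) \<Rightarrow> 'a set set" where
  "monochromatic_edges F \<chi> = {e \<in> F. monochromatic \<chi> e}"

lemma monochromatic_edges_cong:
  assumes "\<And>u. u \<in> \<Union> F \<Longrightarrow> \<chi> u = \<chi>' u"
  shows "monochromatic_edges F \<chi> = monochromatic_edges F \<chi>'"
  unfolding monochromatic_edges_def
  by (intro Collect_cong conj_cong refl monochromatic_cong) (use assms in blast)

lemma card_monochromatic_edges_subset_Diff:
  assumes "finite F" "G \<subseteq> F"
  shows "card (monochromatic_edges F \<chi>) =
    card (monochromatic_edges G \<chi>) + card (monochromatic_edges (F - G) \<chi>)"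
proof -
  have "monochromatic_edges F \<chi> = monochromatic_edges G \<chi> \<union> monochromatic_edges (F - G) \<chi>"
    using \<open>G \<subseteq> F\<close> by (auto simp: monochromatic_edges_def)
  moreover have "finite (monochromatic_edges H \<chi>)" if "H \<subseteq> F" for H
    by (rule finite_subset[OF _ \<open>finite F\<close>]) (use that in \<open>auto simp: monochromatic_edges_def\<close>)
  moreover have "monochromatic_edges G \<chi> \<inter> monochromatic_edges (F - G) \<chi> = {}"
    by (auto simp: monochromatic_edges_def)
  ultimately show ?thesis
    using \<open>G \<subseteq> F\<close> by (simp add: card_Un_disjoint)
qed

lemma monochromatic_edges_recolour_disjoint:
  assumes graph: "simple_graph V E" and "c \<noteq> \<chi> v"
  shows "monochromatic_edges (incident_edges E v) \<chi> \<inter>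
    monochromatic_edges (incident_edges E v) (\<chi>(v := c)) = {}"
proof -
  have "\<not> monochromatic (\<chi>(v := c)) e" if "e \<in> incident_edges E v" "monochromatic \<chi> e" for e
  proof -
    obtain u where "e = {v, u}" "u \<in> neighbourhood E v"
      using \<open>e \<in> incident_edges E v\<close> by (auto simp: incident_edges_eq_image[OF graph])
    moreover from this have "u \<noteq> v"
      using not_self_neighbour[OF graph] by blast
    ultimately show ?thesis
      using \<open>monochromatic \<chi> e\<close> \<open>c \<noteq> \<chi> v\<close> by simp
  qed
  then show ?thesis
    by (auto simp: monochromatic_edges_def)
qed

definition satisfied :: "'a set set \<Rightarrow> ('a \<Rightarrow> 'c) \<Rightarrow> 'a \<Rightarrow> bool" where
  "satisfied E \<chi> v \<longleftrightarrow>
     2 * card (monochromatic_edges (incident_edges E v) \<chi>) \<le> card (incident_edges E v)"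

lemma satisfied_cong:
  assumes "\<And>u. u \<in> \<Union> (incident_edges E v) \<Longrightarrow> \<chi> u = \<chi>' u"
  shows "satisfied E \<chi> v \<longleftrightarrow> satisfied E \<chi>' v"
  using monochromatic_edges_cong[of "incident_edges E v" \<chi> \<chi>'] assms by (simp add: satisfied_def)

lemma satisfied_if_recolour_not_better:
  assumes graph: "simple_graph V E" and "c \<noteq> \<chi> v"
    and "finite F" "F \<subseteq> E" "incident_edges E v \<subseteq> F"
    and not_better: "card (monochromatic_edges F \<chi>) \<le> card (monochromatic_edges F (\<chi>(v := c)))"
  shows "satisfied E \<chi> v"
proof -
  let ?I = "incident_edges E v" and ?\<chi>' = "\<chi>(v := c)"
  have "finite ?I"
    using \<open>incident_edges E v \<subseteq> F\<close> \<open>finite F\<close> by (rule finite_subset)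
  have "monochromatic_edges (F - ?I) \<chi> = monochromatic_edges (F - ?I) ?\<chi>'"
    by (rule monochromatic_edges_cong) (use \<open>F \<subseteq> E\<close> in \<open>auto simp: incident_edges_def\<close>)
  with not_better have "card (monochromatic_edges ?I \<chi>) \<le> card (monochromatic_edges ?I ?\<chi>')"
    by (simp add: card_monochromatic_edges_subset_Diff[OF \<open>finite F\<close> \<open>?I \<subseteq> F\<close>])
  then have "2 * card (monochromatic_edges ?I \<chi>) \<le>
      card (monochromatic_edges ?I \<chi>) + card (monochromatic_edges ?I ?\<chi>')"
    by simp
  also have "\<dots> = card (monochromatic_edges ?I \<chi> \<union> monochromatic_edges ?I ?\<chi>')"
    using \<open>finite ?I\<close> monochromatic_edges_recolour_disjoint[where \<chi> = \<chi>, OF graph \<open>c \<noteq> \<chi> v\<close>]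
    by (intro card_Un_disjoint[symmetric]) (auto simp: monochromatic_edges_def)
  also have "\<dots> \<le> card ?I"
    by (rule card_mono[OF \<open>finite ?I\<close>]) (auto simp: monochromatic_edges_def)
  finally show ?thesis
    by (simp add: satisfied_def)
qed

lemma exists_colouring_satisfied_on_finite:
  fixes M :: "'a \<Rightarrow> 'c set"
  assumes graph: "simple_graph V E"
    and nonempty: "\<And>v. v \<in> V \<Longrightarrow> M v \<noteq> {}"
    and "finite T" "T \<subseteq> V"
    and finite_degree: "\<And>v. v \<in> T \<Longrightarrow> finite (incident_edges E v)"
    and two_colours: "\<And>v. v \<in> T \<Longrightarrow> 2 \<le> card (M v)"
  shows "\<exists>\<chi> \<in> Pi\<^sub>E V M. \<forall>v\<in>T. satisfied E \<chi> v"
proof -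
  define F where "F = (\<Union>v\<in>T. incident_edges E v)"
  let ?energy = "\<lambda>\<chi>. card (monochromatic_edges F \<chi>)"
  obtain \<chi>\<^sub>0 where "\<chi>\<^sub>0 \<in> Pi\<^sub>E V M"
    using nonempty by (meson PiE_eq_empty_iff ex_in_conv)
  then obtain \<chi> where \<chi>_in_M: "\<chi> \<in> Pi\<^sub>E V M"
    and minimal: "\<And>\<chi>'. \<chi>' \<in> Pi\<^sub>E V M \<Longrightarrow> ?energy \<chi> \<le> ?energy \<chi>'"
    using ex_has_least_nat[of "\<lambda>\<chi>. \<chi> \<in> Pi\<^sub>E V M" \<chi>\<^sub>0 ?energy] by blast
  have "satisfied E \<chi> v" if "v \<in> T" for v
  proof -
    obtain c where "c \<in> M v" "c \<noteq> \<chi> v"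
      using ex_mem_neq_if_two_le_card[OF two_colours[OF \<open>v \<in> T\<close>]] by blast
    have "\<chi>(v := c) \<in> Pi\<^sub>E V M"
      using \<chi>_in_M \<open>c \<in> M v\<close> \<open>v \<in> T\<close> \<open>T \<subseteq> V\<close> by (auto simp: PiE_iff extensional_def)
    then have "?energy \<chi> \<le> ?energy (\<chi>(v := c))"
      by (rule minimal)
    moreover have "finite F" "F \<subseteq> E" "incident_edges E v \<subseteq> F"
      using \<open>finite T\<close> finite_degree \<open>v \<in> T\<close> by (auto simp: F_def incident_edges_def)
    ultimately show ?thesis
      using satisfied_if_recolour_not_better[of V E c \<chi> v F] graph \<open>c \<noteq> \<chi> v\<close> by blast
  qed
  with \<chi>_in_M show ?thesis by blast
qed

lemma exists_colouring_satisfied_finite_degree: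
  fixes M :: "'a \<Rightarrow> 'c set"
  assumes graph: "simple_graph V E"
    and finite_M: "\<And>v. v \<in> V \<Longrightarrow> finite (M v)"
    and nonempty: "\<And>v. v \<in> V \<Longrightarrow> M v \<noteq> {}"
    and two_colours: "\<And>v. v \<in> V \<Longrightarrow> finite (incident_edges E v) \<Longrightarrow> 2 \<le> card (M v)"
  shows "\<exists>\<chi> \<in> Pi\<^sub>E V M. \<forall>v\<in>V. finite (incident_edges E v) \<longrightarrow> satisfied E \<chi> v"
proof -
  let ?I = "{v \<in> V. finite (incident_edges E v)}"
  have "\<exists>\<chi> \<in> Pi\<^sub>E V M. \<forall>v\<in>?I. satisfied E \<chi> v"
  proof (rule exists_PiE_satisfying_finitary)
    show "satisfied E \<chi> v \<longleftrightarrow> satisfied E \<chi>' v"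
      if "\<And>u. u \<in> \<Union> (incident_edges E v) \<Longrightarrow> \<chi> u = \<chi>' u" for v and \<chi> \<chi>' :: "'a \<Rightarrow> 'c"
      using that by (rule satisfied_cong)
    show "finite (\<Union> (incident_edges E v))" if "v \<in> ?I" for v
      using that by (intro finite_Union) (auto simp: incident_edges_eq_image[OF graph])
    show "\<exists>\<chi> \<in> Pi\<^sub>E V M. \<forall>v\<in>J. satisfied E \<chi> v" if "finite J" "J \<subseteq> ?I" for J
      by (rule exists_colouring_satisfied_on_finite[OF graph nonempty]) (use that two_colours in auto)
  qed (rule finite_M)
  then show ?thesis by blast
qed

lemma infinite_later_neighbours:
  assumes graph: "simple_graph V E" and "countable V"
    and infinite_nbhd: "infinite (neighbourhood E v)"
  shows "infinite {u \<in> neighbourhood E v. to_nat_on V v < to_nat_on V u}"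
proof -
  let ?r = "to_nat_on V"
  have "infinite (neighbourhood E v - {u \<in> V. ?r u \<le> ?r v})"
    using infinite_nbhd finite_to_nat_on_le[OF \<open>countable V\<close>] by (simp add: Diff_infinite_finite)
  moreover have "neighbourhood E v - {u \<in> V. ?r u \<le> ?r v} \<subseteq>
      {u \<in> neighbourhood E v. ?r v < ?r u}"
    using neighbourhood_subset[OF graph] by auto
  ultimately show ?thesis
    using finite_subset by blast
qed

lemma exists_colouring_differing_from_claimant:
  fixes L :: "'a \<Rightarrow> 'c set"
  assumes graph: "simple_graph V E" and "countable V"
    and two_colours: "\<And>v. v \<in> V \<Longrightarrow> 2 \<le> card (L v)"
  obtains \<psi> p where "\<And>v. v \<in> V \<Longrightarrow> \<psi> v \<in> L v"
    "\<And>v. v \<in> V \<Longrightarrow> infinite (neighbourhood E v) \<Longrightarrow>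
      infinite {u \<in> neighbourhood E v. p u = v \<and> \<psi> u \<noteq> \<psi> v}"
proof -
  let ?N = "neighbourhood E" and ?r = "to_nat_on V"
  let ?I = "{v \<in> V. infinite (?N v)}"
  define later where "later v = {u \<in> ?N v. ?r v < ?r u}" for v
  have "countable ?I"
    using \<open>countable V\<close> by simp
  moreover have "infinite (later v)" if "v \<in> ?I" for v
    using that infinite_later_neighbours[OF graph \<open>countable V\<close>] by (simp add: later_def)
  ultimately obtain p where infinite_fibre: "\<And>v. v \<in> ?I \<Longrightarrow> infinite {u \<in> later v. p u = v}"
    using exists_infinite_fibres[of ?I later] by blast
  obtain \<psi> where \<psi>_in_L: "\<And>u. u \<in> V \<Longrightarrow> \<psi> u \<in> L u"
    and \<psi>_neq: "\<And>u. u \<in> V \<Longrightarrow> (p u, u) \<in> measure ?r \<Longrightarrow> \<psi> u \<noteq> \<psi> (p u)"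
    using exists_choice_avoiding_parent[of "measure ?r" V L p, OF wf_measure two_colours] by blast
  have "infinite {u \<in> ?N v. p u = v \<and> \<psi> u \<noteq> \<psi> v}" if "v \<in> V" "infinite (?N v)" for v
  proof -
    have "{u \<in> later v. p u = v} \<subseteq> {u \<in> ?N v. p u = v \<and> \<psi> u \<noteq> \<psi> v}"
      using \<psi>_neq neighbourhood_subset[OF graph] by (auto simp: later_def)
    moreover have "infinite {u \<in> later v. p u = v}"
      using infinite_fibre that by blast
    ultimately show ?thesis
      using finite_subset by blast
  qed
  with \<psi>_in_L show thesis by (rule that)
qed

lemma nonmonochromatic_edges_eqpoll_neighbourhood:
  assumes graph: "simple_graph V E" and "countable V"
    and infinite_differing: "infinite {u \<in> neighbourhood E v. \<chi> u \<noteq> \<chi> v}"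
  shows "{e \<in> incident_edges E v. \<not> monochromatic \<chi> e} \<approx> neighbourhood E v"
proof -
  let ?U = "{u \<in> neighbourhood E v. \<chi> u \<noteq> \<chi> v}"
  have "{e \<in> incident_edges E v. \<not> monochromatic \<chi> e} = (\<lambda>u. {v, u}) ` ?U"
    by (auto simp: incident_edges_eq_image[OF graph])
  also have "\<dots> \<approx> ?U"
    by (intro inj_on_image_eqpoll_self inj_on_subset[OF inj_doubleton]) auto
  also have "\<dots> \<approx> neighbourhood E v"
  proof (rule countable_infinite_eqpoll)
    show "countable (neighbourhood E v)"
      using neighbourhood_subset[OF graph] \<open>countable V\<close> by (rule countable_subset)
    then show "countable ?U"
      by (rule countable_Collect)
    show "infinite (neighbourhood E v)"
      using infinite_differing by auto
  qed (rule infinite_differing)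
  finally show ?thesis .
qed

lemma majority_colouringI:
  assumes graph: "simple_graph V E" and "countable V"
    and satisfied: "\<And>v. v \<in> V \<Longrightarrow> finite (incident_edges E v) \<Longrightarrow> satisfied E \<chi> v"
    and infinite_differing: "\<And>v. v \<in> V \<Longrightarrow> infinite (neighbourhood E v) \<Longrightarrow>
      infinite {u \<in> neighbourhood E v. \<chi> u \<noteq> \<chi> v}"
  shows "majority_colouring V E \<chi>"
  unfolding majority_colouring_def
proof (intro ballI)
  fix v assume "v \<in> V"
  show "if finite (incident_edges E v)
      then 2 * card {e \<in> incident_edges E v. monochromatic \<chi> e} \<le> card (incident_edges E v)
      else {e \<in> incident_edges E v. \<not> monochromatic \<chi> e} \<approx> neighbourhood E v"
  proof (cases "finite (incident_edges E v)")
    case True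
    with satisfied[OF \<open>v \<in> V\<close>] show ?thesis
      by (simp add: satisfied_def monochromatic_edges_def)
  next
    case False
    then have "infinite {u \<in> neighbourhood E v. \<chi> u \<noteq> \<chi> v}"
      using infinite_differing[OF \<open>v \<in> V\<close>] by (simp add: finite_incident_edges_iff[OF graph])
    with False nonmonochromatic_edges_eqpoll_neighbourhood[OF graph \<open>countable V\<close>]
    show ?thesis by auto
  qed
qed

definition residual_list ::
    "'a set set \<Rightarrow> ('a \<Rightarrow> 'a) \<Rightarrow> ('a \<Rightarrow> 'c) \<Rightarrow> ('a \<Rightarrow> 'c set) \<Rightarrow> 'a \<Rightarrow> 'c set" where
  "residual_list E p \<psi> L v =
     (if finite (neighbourhood E v) then L v - {\<psi> (p v)} else {\<psi> v})"

lemma residual_list_subset: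
  assumes "\<psi> v \<in> L v"
  shows "residual_list E p \<psi> L v \<subseteq> L v"
  using assms by (auto simp: residual_list_def)

lemma two_le_card_residual_list:
  assumes "3 \<le> card (L v)" "finite (neighbourhood E v)"
  shows "2 \<le> card (residual_list E p \<psi> L v)"
  using assms diff_card_le_card_Diff[of "{\<psi> (p v)}" "L v"] by (simp add: residual_list_def)

lemma residual_list_nonempty:
  assumes "3 \<le> card (L v)"
  shows "residual_list E p \<psi> L v \<noteq> {}"
proof (cases "finite (neighbourhood E v)")
  case True
  with two_le_card_residual_list[of L v E p \<psi>] assms show ?thesis by auto
qed (simp add: residual_list_def)

lemma infinite_differing_neighbours:
  assumes graph: "simple_graph V E"
    and residual: "\<And>u. u \<in> V \<Longrightarrow> \<chi> u \<in> residual_list E p \<psi> L u"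
    and "v \<in> V" "infinite (neighbourhood E v)"
    and claims: "infinite {u \<in> neighbourhood E v. p u = v \<and> \<psi> u \<noteq> \<psi> v}"
  shows "infinite {u \<in> neighbourhood E v. \<chi> u \<noteq> \<chi> v}"
proof -
  have "\<chi> v = \<psi> v"
    using residual[of v] assms(3,4) by (simp add: residual_list_def)
  moreover have "\<chi> u \<noteq> \<psi> v" if "u \<in> neighbourhood E v" "p u = v" "\<psi> u \<noteq> \<psi> v" for u
    using residual[of u] that neighbourhood_subset[OF graph, of v]
    by (auto simp: residual_list_def split: if_splits)
  ultimately have "{u \<in> neighbourhood E v. p u = v \<and> \<psi> u \<noteq> \<psi> v} \<subseteq>
      {u \<in> neighbourhood E v. \<chi> u \<noteq> \<chi> v}"
    by auto
  with claims show ?thesis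
    using finite_subset by blast
qed

lemma exists_majority_colouring:
  fixes L :: "'a \<Rightarrow> 'c set"
  assumes graph: "simple_graph V E" and "countable V"
    and finite_L: "\<And>v. v \<in> V \<Longrightarrow> finite (L v)"
    and three_colours: "\<And>v. v \<in> V \<Longrightarrow> 3 \<le> card (L v)"
  shows "\<exists>\<chi>. majority_colouring V E \<chi> \<and> (\<forall>v\<in>V. \<chi> v \<in> L v)"
proof -
  let ?N = "neighbourhood E"
  have "2 \<le> card (L v)" if "v \<in> V" for v
    using three_colours[OF that] by simp
  then obtain \<psi> p where \<psi>_in_L: "\<And>v. v \<in> V \<Longrightarrow> \<psi> v \<in> L v"
    and claims: "\<And>v. v \<in> V \<Longrightarrow> infinite (?N v) \<Longrightarrow> infinite {u \<in> ?N v. p u = v \<and> \<psi> u \<noteq> \<psi> v}"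
    using exists_colouring_differing_from_claimant[OF graph \<open>countable V\<close>] by blast
  let ?M = "residual_list E p \<psi> L"
  have M_subset: "?M v \<subseteq> L v" if "v \<in> V" for v
    using \<psi>_in_L[OF that] by (rule residual_list_subset)
  have "\<exists>\<chi> \<in> Pi\<^sub>E V ?M. \<forall>v\<in>V. finite (incident_edges E v) \<longrightarrow> satisfied E \<chi> v"
  proof (rule exists_colouring_satisfied_finite_degree[OF graph])
    show "finite (?M v)" if "v \<in> V" for v
      using M_subset[OF that] finite_L[OF that] by (rule finite_subset)
    show "?M v \<noteq> {}" if "v \<in> V" for v
      using three_colours[OF that] by (rule residual_list_nonempty)
    show "2 \<le> card (?M v)" if "v \<in> V" "finite (incident_edges E v)" for v
      using three_colours that
      by (intro two_le_card_residual_list) (simp_all add: finite_incident_edges_iff[OF graph])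
  qed
  then obtain \<chi> where \<chi>_in_M: "\<And>v. v \<in> V \<Longrightarrow> \<chi> v \<in> ?M v"
    and satisfied: "\<And>v. v \<in> V \<Longrightarrow> finite (incident_edges E v) \<Longrightarrow> satisfied E \<chi> v"
    by blast
  have "infinite {u \<in> ?N v. \<chi> u \<noteq> \<chi> v}" if "v \<in> V" "infinite (?N v)" for v
    using infinite_differing_neighbours[OF graph \<chi>_in_M that claims[OF that]] .
  with satisfied have "majority_colouring V E \<chi>"
    by (intro majority_colouringI[OF graph \<open>countable V\<close>])
  with \<chi>_in_M M_subset show ?thesis
    by blast
qed

theorem theorem5:
  fixes V :: "'a set" and E :: "'a set set"
  assumes "simple_graph V E"
    and "countable V"
  shows "majority_choosable TYPE('c) 3 V E"
  unfolding majority_choosable_def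
proof (intro allI impI)
  fix L :: "'a \<Rightarrow> 'c set"
  assume "\<forall>v\<in>V. finite (L v) \<and> card (L v) = 3"
  then show "\<exists>\<chi>. majority_colouring V E \<chi> \<and> (\<forall>v\<in>V. \<chi> v \<in> L v)"
    by (intro exists_majority_colouring[OF assms]) auto
qed

end
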